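(* Assume the multicolor Erdős–Hajnal conjecture: for all integers $k,m\ge 2$ and every coloring $\chi$ of $E(K_k)$ with $m$ colors, there exists $\varepsilon>0$ such that every coloring of the edges of $K_n$ with these $m$ colors contains either $k$ vertices whose edges are colored according to $\chi$ (i.e. a copy of $\chi$) or a set of $n^\varepsilon$ vertices whose edges use at most $m-1$ colors. Then for every grid subgraph $H$ such that no two horizontal edges of $H$ join the same two columns, $H\in\mathbf{PGR}$, i.e. there is a constant $C_H$ with $\operatorname{gr}(H,K_k)\le k^{C_H}$ for all $k\ge 2$.
   Context: A grid subgraph on $c$ columns and $r$ rows is a graph whose vertex set is a subset of $[c]\times[r]$ (vertex $(x,y)$ lies in column $x$, row $y$) and whose edges each join two vertices in the same row (horizontal edge) or the same column (vertical edge). A horizontal edge $\{(x,y),(x',y)\}$ is said to be between columns $x$ and $x'$. $G_{N\times N}=K_N\square K_N$; a spanning grid subgraph is a spanning subgraph of it. An embedding of $H$ (on $c_H$ columns, $r_H$ rows) into $G$ is a pair of injections $\varphi_c:[c_H]\to[c_G]$, $\varphi_r:[r_H]\to[r_G]$ sending each edge $\{(x,y),(x',y')\}$ of $H$ to an edge $\{(\varphi_c(x),\varphi_r(y)),(\varphi_c(x'),\varphi_r(y'))\}$ of $G$; $G$ contains $H$ if one exists. A coclique of size $k$ is a set of $k$ pairwise non-adjacent vertices all in one row or all in one column. $\operatorname{gr}(H,K_k)$ is the least $N$ such that every spanning grid subgraph of $G_{N\times N}$ contains $H$ or a coclique of size $k$. $\mathbf{PGR}$ is the class of grid subgraphs $H$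 with $\operatorname{gr}(H,K_k)=k^{O_H(1)}$. *)

theory Defs
  imports Complex_Main "HOL-Library.FuncSet" "HOL-Library.Extended_Nat" "HOL-Library.Ramsey"
begin

text \<open>The pair \<open>(x, y)\<close> is the point in column \<open>x\<close> and row \<open>y\<close>; edges are two-element sets of points.\<close>

record grid_graph =
  cols :: nat
  rows :: nat
  verts :: "(nat \<times> nat) set"
  edges :: "(nat \<times> nat) set set"

definition grid_subgraph :: "grid_graph \<Rightarrow> bool" where
  "grid_subgraph H \<longleftrightarrow>
     verts H \<subseteq> {1..cols H} \<times> {1..rows H} \<and>
     (\<forall>e\<in>edges H. \<exists>x y x' y'. e = {(x, y), (x', y')} \<and>
        (x, y) \<in> verts H \<and> (x', y') \<in> verts H \<and> (x, y) \<noteq> (x', y') \<and> (x = x' \<or> y = y'))"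

definition horizontal_edge_between :: "grid_graph \<Rightarrow> (nat \<times> nat) set \<Rightarrow> nat \<Rightarrow> nat \<Rightarrow> bool" where
  "horizontal_edge_between H e x x' \<longleftrightarrow>
     e \<in> edges H \<and> x \<noteq> x' \<and> (\<exists>y. e = {(x, y), (x', y)})"

definition complete_grid :: "nat \<Rightarrow> grid_graph" where
  "complete_grid N =
     \<lparr> cols = N, rows = N, verts = {1..N} \<times> {1..N},
       edges = {{(x, y), (x', y')} | x y x' y'.
         x \<in> {1..N} \<and> y \<in> {1..N} \<and> x' \<in> {1..N} \<and> y' \<in> {1..N} \<and>
         (x, y) \<noteq> (x', y') \<and> (x = x' \<or> y = y')} \<rparr>"

definition spanning_grid_subgraph :: "nat \<Rightarrow> grid_graph \<Rightarrow> bool" where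
  "spanning_grid_subgraph N G \<longleftrightarrow>
     cols G = N \<and> rows G = N \<and>
     verts G = verts (complete_grid N) \<and> edges G \<subseteq> edges (complete_grid N)"

definition grid_embedding ::
    "grid_graph \<Rightarrow> grid_graph \<Rightarrow> (nat \<Rightarrow> nat) \<Rightarrow> (nat \<Rightarrow> nat) \<Rightarrow> bool" where
  "grid_embedding H G \<phi>\<^sub>c \<phi>\<^sub>r \<longleftrightarrow>
     \<phi>\<^sub>c \<in> {1..cols H} \<rightarrow> {1..cols G} \<and> inj_on \<phi>\<^sub>c {1..cols H} \<and>
     \<phi>\<^sub>r \<in> {1..rows H} \<rightarrow> {1..rows G} \<and> inj_on \<phi>\<^sub>r {1..rows H} \<and>
     (\<forall>x y x' y'. {(x, y), (x', y')} \<in> edges H \<longrightarrow>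
        {(\<phi>\<^sub>c x, \<phi>\<^sub>r y), (\<phi>\<^sub>c x', \<phi>\<^sub>r y')} \<in> edges G)"

definition grid_contains :: "grid_graph \<Rightarrow> grid_graph \<Rightarrow> bool" where
  "grid_contains G H \<longleftrightarrow> (\<exists>\<phi>\<^sub>c \<phi>\<^sub>r. grid_embedding H G \<phi>\<^sub>c \<phi>\<^sub>r)"

definition grid_coclique :: "grid_graph \<Rightarrow> nat \<Rightarrow> (nat \<times> nat) set \<Rightarrow> bool" where
  "grid_coclique G k S \<longleftrightarrow>
     S \<subseteq> verts G \<and> finite S \<and> card S = k \<and>
     pairwise (\<lambda>u v. {u, v} \<notin> edges G) S \<and>
     ((\<exists>y. \<forall>v\<in>S. snd v = y) \<or> (\<exists>x. \<forall>v\<in>S. fst v = x))"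

text \<open>The infimum is taken in \<open>enat\<close>, so that it is \<open>\<infinity>\<close>, rather than an unspecified number,
  if no \<open>N\<close> qualifies. In particular any finite bound on it includes the existence of such an \<open>N\<close>.\<close>

definition gr :: "grid_graph \<Rightarrow> nat \<Rightarrow> enat" where
  "gr H k = Inf (enat ` {N. \<forall>G. spanning_grid_subgraph N G \<longrightarrow>
     grid_contains G H \<or> (\<exists>S. grid_coclique G k S)})"

definition PGR :: "grid_graph set" where
  "PGR = {H. grid_subgraph H \<and> (\<exists>C::nat. \<forall>k\<ge>2. gr H k \<le> enat (k ^ C))}"

text \<open>A colouring of the edges of \<open>K\<^sub>n\<close> with \<open>m\<close> colours need not use all the colours.\<close>

definition edge_colouring :: "nat \<Rightarrow> nat \<Rightarrow> (nat set \<Rightarrow> nat) \<Rightarrow> bool" where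
  "edge_colouring n m c \<longleftrightarrow> c \<in> nsets {1..n} 2 \<rightarrow> {1..m}"

definition contains_colour_copy ::
    "nat \<Rightarrow> (nat set \<Rightarrow> nat) \<Rightarrow> nat \<Rightarrow> (nat set \<Rightarrow> nat) \<Rightarrow> bool" where
  "contains_colour_copy n c k \<chi> \<longleftrightarrow>
     (\<exists>f. f \<in> {1..k} \<rightarrow> {1..n} \<and> inj_on f {1..k} \<and> (\<forall>e\<in>nsets {1..k} 2. c (f ` e) = \<chi> e))"

definition multicolour_erdos_hajnal :: bool where
  "multicolour_erdos_hajnal \<longleftrightarrow>
     (\<forall>k\<ge>2. \<forall>m\<ge>2. \<forall>\<chi>. edge_colouring k m \<chi> \<longrightarrow>
       (\<exists>\<epsilon>>0::real. \<forall>n c. edge_colouring n m c \<longrightarrow>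
          contains_colour_copy n c k \<chi> \<or>
          (\<exists>S\<subseteq>{1..n}. real (card S) \<ge> real n powr \<epsilon> \<and> card (c ` nsets S 2) \<le> m - 1)))"

end

theory Submission
  imports Defs
begin

text \<open>By Ramsey and pigeonhole, a grid without a coclique of size \<open>k\<close> has many columns in which
  the same \<open>rows H\<close> rows form a vertical clique. Colour a pair of these columns by the \<^emph>\<open>set\<close> of those
  rows in which it is joined, and permit for a pair of columns of \<open>H\<close> the sets that contain every row
  joining it in \<open>H\<close>; a copy with permitted colours is an embedding of \<open>H\<close>. If every pair has a permitted
  colour among the available ones, Erdos-Hajnal gives such a copy or a polynomially large set of columns
  with fewer colours. Iterating, either \<open>H\<close> is found or no available colour is permitted for some
  pair. As a single row joins that pair in \<open>H\<close>, the remaining columns form a coclique in the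
  corresponding row.\<close>

section \<open>Ramsey bounds\<close>

lemma binomial_add_le_power: "n + k choose n \<le> Suc k ^ n"
proof (induction n)
  case (Suc n)
  have "Suc n * (Suc n + k choose Suc n) = Suc (n + k) * (n + k choose n)"
    using Suc_times_binomial[of n "n + k"] by simp
  also have "\<dots> \<le> (Suc n * Suc k) * Suc k ^ n"
    using Suc.IH by (intro mult_mono) auto
  finally have "Suc n * (Suc n + k choose Suc n) \<le> Suc n * Suc k ^ Suc n"
    by (simp only: mult.assoc power_Suc)
  then show ?case by (simp only: Suc_mult_le_cancel1)
qed simp

lemma ramsey2_binomial:
  assumes "finite V" and "s + k choose s \<le> card V"
  shows "\<exists>R\<subseteq>V. card R = s \<and> clique R E \<or> card R = k \<and> indep R E"
proof -
  define N where "N = ES 2 s k"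
  have "card {..<N} \<le> card V" using assms(2) by (simp add: N_def ES2_choose)
  then obtain v where v: "v ` {..<N} \<subseteq> V" "inj_on v {..<N}"
    using card_le_inj[OF finite_lessThan \<open>finite V\<close>] by blast
  define colour where "colour e = (if v ` e \<in> E then 0 else Suc 0)" for e
  have "colour \<in> [{..<N}]\<^bsup>2\<^esup> \<rightarrow> {..<2}" by (simp add: colour_def)
  with ramsey2_full[of 2 s k, folded N_def]
  obtain i U where i: "i < 2" and U: "U \<in> [{..<N}]\<^bsup>([s, k] ! i)\<^esup>"
    and mono: "colour ` [U]\<^bsup>2\<^esup> \<subseteq> {i}"
    by (rule partn_lstE) (auto simp: numeral_2_eq_2)
  have "U \<subseteq> {..<N}" using U by (simp add: nsets_def)
  then have "v ` U \<subseteq> V" and card_vU: "card (v ` U) = [s, k] ! i"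
    using v U by (auto simp: nsets_def card_image inj_on_subset)
  have colour_i: "colour {a, b} = i" if "a \<in> U" "b \<in> U" "v a \<noteq> v b" for a b
    using mono that by (auto simp: image_subset_iff)
  consider (clique) "i = 0" | (indep) "i = 1" using i by linarith
  then have "card (v ` U) = s \<and> clique (v ` U) E \<or> card (v ` U) = k \<and> indep (v ` U) E"
  proof cases
    case clique
    then have "clique (v ` U) E"
      using colour_i by (fastforce simp: clique_def colour_def split: if_splits)
    then show ?thesis using clique card_vU by simp
  next
    case indep
    then have "indep (v ` U) E"
      using colour_i by (fastforce simp: indep_def colour_def split: if_splits)
    then show ?thesis using indep card_vU by simp
  qed
  with \<open>v ` U \<subseteq> V\<close> show ?thesis by blast
qed

lemma ramsey2_power:
  assumes "finite V" and "2 \<le> k" and "k ^ (2 * s) \<le> card V"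
  shows "\<exists>R\<subseteq>V. card R = s \<and> clique R E \<or> card R = k \<and> indep R E"
proof (rule ramsey2_binomial[OF \<open>finite V\<close>])
  have "Suc k \<le> 2 * k" using \<open>2 \<le> k\<close> by simp
  also have "\<dots> \<le> k\<^sup>2" using \<open>2 \<le> k\<close> by (simp add: power2_eq_square)
  finally have "Suc k ^ s \<le> k ^ (2 * s)" by (simp only: power_mult power_mono)
  then show "s + k choose s \<le> card V"
    using binomial_add_le_power[of s k] assms(3) by linarith
qed

lemma common_clique_of_many_graphs:
  fixes E :: "'x \<Rightarrow> 'a set set"
  assumes "finite X" and "2 \<le> k" and X: "k ^ (2 * R * R + D) \<le> card X" and Y: "k ^ (2 * R) \<le> card Y"
    and no_indep: "\<And>x S. x \<in> X \<Longrightarrow> S \<subseteq> Y \<Longrightarrow> card S = k \<Longrightarrow> \<not> indep S (E x)"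
  obtains K V where "K \<in> [Y]\<^bsup>R\<^esup>" "V \<subseteq> X" "k ^ D \<le> card V" "\<And>x. x \<in> V \<Longrightarrow> clique K (E x)"
proof -
  obtain Y' where Y': "Y' \<subseteq> Y" "card Y' = k ^ (2 * R)" "finite Y'"
    using obtain_subset_with_card_n[OF Y] by blast
  have "\<exists>K\<in>[Y']\<^bsup>R\<^esup>. clique K (E x)" if "x \<in> X" for x
  proof -
    obtain K where "K \<subseteq> Y'" "card K = R \<and> clique K (E x) \<or> card K = k \<and> indep K (E x)"
      using ramsey2_power[OF \<open>finite Y'\<close> \<open>2 \<le> k\<close>, of R "E x"] Y' by auto
    then show ?thesis
      using no_indep[OF that] Y' by (auto simp: nsets_def intro: finite_subset)
  qed
  then obtain q where q: "q \<in> X \<rightarrow> [Y']\<^bsup>R\<^esup>" and clique_q: "\<And>x. x \<in> X \<Longrightarrow> clique (q x) (E x)"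
    by (metis Pi_I)
  have "0 < card X" using X \<open>2 \<le> k\<close> by (intro less_le_trans[OF _ X]) simp
  then have "[Y']\<^bsup>R\<^esup> \<noteq> {}" using q by (auto simp: card_gt_0_iff)
  then obtain K where K: "K \<in> [Y']\<^bsup>R\<^esup>"
    and fibre: "card X \<le> card (q -` {K} \<inter> X) * card ([Y']\<^bsup>R\<^esup>)"
    using pigeonhole_card[OF q \<open>finite X\<close> finite_imp_finite_nsets[OF \<open>finite Y'\<close>]] by blast
  have card_R_sets: "card ([Y']\<^bsup>R\<^esup>) \<le> k ^ (2 * R * R)"
    using binomial_le_pow[of R "k ^ (2 * R)"] Y'
    by (cases "R \<le> k ^ (2 * R)") (simp_all add: power_mult binomial_eq_0)
  have "k ^ D * k ^ (2 * R * R) \<le> card X" using X by (simp add: power_add mult.commute)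
  also note fibre
  also have "card (q -` {K} \<inter> X) * card ([Y']\<^bsup>R\<^esup>) \<le> card (q -` {K} \<inter> X) * k ^ (2 * R * R)"
    by (rule mult_le_mono2[OF card_R_sets])
  finally have "k ^ D \<le> card (q -` {K} \<inter> X)" using \<open>2 \<le> k\<close> by simp
  moreover have "K \<in> [Y]\<^bsup>R\<^esup>" using K nsets_mono[OF Y'(1)] by blast
  ultimately show thesis using clique_q by (intro that[of K "q -` {K} \<inter> X"]) auto
qed

section \<open>Exponents in the multicolour Erdos-Hajnal property\<close>

definition erdos_hajnal_exponent :: "nat \<Rightarrow> nat \<Rightarrow> (nat set \<Rightarrow> nat) \<Rightarrow> nat \<Rightarrow> bool" where
  "erdos_hajnal_exponent p m \<chi> D \<longleftrightarrow>
     (\<forall>n c k. edge_colouring n m c \<longrightarrow> 1 \<le> k \<longrightarrow> k ^ D \<le> n \<longrightarrow>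
       contains_colour_copy n c p \<chi> \<or> (\<exists>S\<subseteq>{1..n}. k \<le> card S \<and> card (c ` [S]\<^bsup>2\<^esup>) < m))"

lemma erdos_hajnal_exponent_mono:
  assumes "erdos_hajnal_exponent p m \<chi> D" and "D \<le> D'"
  shows "erdos_hajnal_exponent p m \<chi> D'"
  unfolding erdos_hajnal_exponent_def
proof (intro allI impI)
  fix n c and k :: nat assume "edge_colouring n m c" "1 \<le> k" "k ^ D' \<le> n"
  moreover from this have "k ^ D \<le> n"
    using power_increasing[OF \<open>D \<le> D'\<close> \<open>1 \<le> k\<close>] by linarith
  ultimately show "contains_colour_copy n c p \<chi> \<or> (\<exists>S\<subseteq>{1..n}. k \<le> card S \<and> card (c ` [S]\<^bsup>2\<^esup>) < m)"
    using assms(1) unfolding erdos_hajnal_exponent_def by blast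
qed

lemma erdos_hajnal_exponent_restrict:
  "erdos_hajnal_exponent p m (restrict \<chi> ([{1..p}]\<^bsup>2\<^esup>)) D \<longleftrightarrow> erdos_hajnal_exponent p m \<chi> D"
  by (simp add: erdos_hajnal_exponent_def contains_colour_copy_def)

lemma of_nat_le_powr_if_power_le:
  fixes \<epsilon> :: real
  assumes "1 \<le> real D * \<epsilon>" and "0 < \<epsilon>" and "1 \<le> k" and "k ^ D \<le> n"
  shows "real k \<le> real n powr \<epsilon>"
proof -
  have "real k = real k powr 1" using assms by simp
  also have "\<dots> \<le> real k powr (real D * \<epsilon>)" using assms by (intro powr_mono) auto
  also have "\<dots> = real (k ^ D) powr \<epsilon>"
    using assms by (simp add: powr_powr [symmetric] powr_realpow)
  also have "\<dots> \<le> real n powr \<epsilon>"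
    using assms by (intro powr_mono2) (auto simp flip: of_nat_power)
  finally show ?thesis .
qed

lemma ex_erdos_hajnal_exponent:
  assumes EH: "multicolour_erdos_hajnal" and "2 \<le> m" and \<chi>: "edge_colouring p m \<chi>"
  shows "\<exists>D. erdos_hajnal_exponent p m \<chi> D"
proof (cases "2 \<le> p")
  case True
  with EH \<chi> \<open>2 \<le> m\<close> obtain \<epsilon> :: real where "\<epsilon> > 0" and \<epsilon>: "\<And>n c. edge_colouring n m c \<Longrightarrow>
     contains_colour_copy n c p \<chi> \<or>
     (\<exists>S\<subseteq>{1..n}. real (card S) \<ge> real n powr \<epsilon> \<and> card (c ` [S]\<^bsup>2\<^esup>) \<le> m - 1)"
    unfolding multicolour_erdos_hajnal_def by meson
  define D where "D = nat \<lceil>1 / \<epsilon>\<rceil>"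
  have "1 / \<epsilon> \<le> real D" unfolding D_def by linarith
  then have "1 \<le> real D * \<epsilon>" using \<open>\<epsilon> > 0\<close> by (simp add: field_simps)
  note large = of_nat_le_powr_if_power_le[OF this \<open>\<epsilon> > 0\<close>]
  have "contains_colour_copy n c p \<chi> \<or> (\<exists>S\<subseteq>{1..n}. k \<le> card S \<and> card (c ` [S]\<^bsup>2\<^esup>) < m)"
    if c: "edge_colouring n m c" and k: "1 \<le> k" "k ^ D \<le> n" for n c k
    using \<epsilon>[OF c]
  proof (elim disjE exE conjE)
    fix S assume S: "S \<subseteq> {1..n}" "real n powr \<epsilon> \<le> real (card S)" "card (c ` [S]\<^bsup>2\<^esup>) \<le> m - 1"
    have "k \<le> card S" using order_trans[OF large[OF k] S(2)] by simp
    moreover have "card (c ` [S]\<^bsup>2\<^esup>) < m" using S(3) \<open>2 \<le> m\<close> by linarith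
    ultimately show ?thesis using S(1) by blast
  qed blast
  then show ?thesis unfolding erdos_hajnal_exponent_def by blast
next
  case False
  have "contains_colour_copy n c p \<chi>" if "1 \<le> n" for n c
    using False that by (auto simp: contains_colour_copy_def nsets_eq_empty intro!: exI[of _ id])
  then have "erdos_hajnal_exponent p m \<chi> 1" by (simp add: erdos_hajnal_exponent_def)
  then show ?thesis ..
qed

lemma ex_uniform_erdos_hajnal_exponent:
  assumes EH: "multicolour_erdos_hajnal" and "2 \<le> m"
  shows "\<exists>D. \<forall>\<chi>. edge_colouring p m \<chi> \<longrightarrow> erdos_hajnal_exponent p m \<chi> D"
proof -
  define X where "X = [{1..p}]\<^bsup>2\<^esup> \<rightarrow>\<^sub>E {1..m}"
  have "finite X" unfolding X_def by (intro finite_PiE) (auto simp: finite_imp_finite_nsets)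
  have "\<forall>\<chi>\<in>X. \<exists>D. erdos_hajnal_exponent p m \<chi> D"
    using ex_erdos_hajnal_exponent[OF EH \<open>2 \<le> m\<close>] by (auto simp: X_def edge_colouring_def PiE_def)
  then obtain d where d: "\<And>\<chi>. \<chi> \<in> X \<Longrightarrow> erdos_hajnal_exponent p m \<chi> (d \<chi>)" by metis
  have "erdos_hajnal_exponent p m \<chi> (Max (d ` X))" if "edge_colouring p m \<chi>" for \<chi>
  proof -
    have X: "restrict \<chi> ([{1..p}]\<^bsup>2\<^esup>) \<in> X" using that by (auto simp: X_def edge_colouring_def)
    then have "d (restrict \<chi> ([{1..p}]\<^bsup>2\<^esup>)) \<le> Max (d ` X)" using \<open>finite X\<close> by simp
    with d[OF X] have "erdos_hajnal_exponent p m (restrict \<chi> ([{1..p}]\<^bsup>2\<^esup>)) (Max (d ` X))"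
      by (rule erdos_hajnal_exponent_mono)
    then show ?thesis by (simp only: erdos_hajnal_exponent_restrict)
  qed
  then show ?thesis by blast
qed

section \<open>Copies with permitted colours\<close>

definition permitted_copy ::
    "'c set \<Rightarrow> ('c set \<Rightarrow> 'b set) \<Rightarrow> 'a set \<Rightarrow> ('a set \<Rightarrow> 'b) \<Rightarrow> bool" where
  "permitted_copy W L V g \<longleftrightarrow> (\<exists>f\<in>W \<rightarrow> V. inj_on f W \<and> (\<forall>e\<in>[W]\<^bsup>2\<^esup>. g (f ` e) \<in> L e))"

definition avoids_permitted ::
    "nat \<Rightarrow> 'c set \<Rightarrow> ('c set \<Rightarrow> 'b set) \<Rightarrow> 'a set \<Rightarrow> ('a set \<Rightarrow> 'b) \<Rightarrow> bool" where
  "avoids_permitted k W L V g \<longleftrightarrow> (\<exists>e\<in>[W]\<^bsup>2\<^esup>. \<exists>S\<subseteq>V. k \<le> card S \<and> g ` [S]\<^bsup>2\<^esup> \<inter> L e = {})"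

lemma permitted_copy_mono:
  assumes "permitted_copy W L V g" and "V \<subseteq> V'" and "\<And>e. e \<in> [W]\<^bsup>2\<^esup> \<Longrightarrow> L e \<subseteq> L' e"
  shows "permitted_copy W L' V' g"
  using assms unfolding permitted_copy_def by fast

lemma avoids_permitted_mono:
  assumes "avoids_permitted k W L V g" and "k' \<le> k" and "V \<subseteq> V'"
  shows "avoids_permitted k' W L V' g"
  using assms unfolding avoids_permitted_def by (meson order_trans)

lemma contains_colour_copy_eq_permitted_copy:
  "contains_colour_copy n c p \<chi> \<longleftrightarrow> permitted_copy {1..p} (\<lambda>e. {\<chi> e}) {1..n} c"
  by (auto simp: contains_colour_copy_def permitted_copy_def)

lemma permitted_copy_reindex:
  assumes "permitted_copy W L U (\<lambda>e. g (h ` e))" and "bij_betw h U V"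
  shows "permitted_copy W L V g"
proof -
  obtain f where f: "f \<in> W \<rightarrow> U" "inj_on f W" "\<And>e. e \<in> [W]\<^bsup>2\<^esup> \<Longrightarrow> g (h ` f ` e) \<in> L e"
    using assms(1) unfolding permitted_copy_def by blast
  have "h \<circ> f \<in> W \<rightarrow> V" using f(1) bij_betwE[OF assms(2)] by auto
  moreover have "inj_on (h \<circ> f) W"
    using f(1,2) assms(2) by (auto simp: bij_betw_def intro!: comp_inj_on intro: inj_on_subset)
  ultimately show ?thesis
    using f(3) unfolding permitted_copy_def by (metis image_comp)
qed

lemma image_nsets_reindex:
  assumes "inj_on h S"
  shows "(\<lambda>e. g (h ` e)) ` [S]\<^bsup>n\<^esup> = g ` [h ` S]\<^bsup>n\<^esup>"
  using bij_betw_imp_surj_on[OF bij_betw_nsets[OF inj_on_imp_bij_betw[OF assms]]]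
  by (metis image_image)

lemma card_image_nsets_relabel:
  assumes "inj_on h S" and "inj_on l F" and "g ` [h ` S]\<^bsup>n\<^esup> \<subseteq> F"
  shows "card ((\<lambda>e. l (g (h ` e))) ` [S]\<^bsup>n\<^esup>) = card (g ` [h ` S]\<^bsup>n\<^esup>)"
proof -
  have "(\<lambda>e. l (g (h ` e))) ` [S]\<^bsup>n\<^esup> = l ` g ` [h ` S]\<^bsup>n\<^esup>"
    using image_nsets_reindex[OF assms(1), of "\<lambda>e. l (g e)"] by (simp only: image_image)
  then show ?thesis using inj_on_subset[OF assms(2,3)] by (simp only: card_image)
qed

lemma permitted_copy_relabel:
  assumes "permitted_copy W (\<lambda>e. {l (\<chi> e)}) V (\<lambda>e. l (g e))"
    and l: "inj_on l F" and g: "g ` [V]\<^bsup>2\<^esup> \<subseteq> F" and \<chi>: "\<chi> ` [W]\<^bsup>2\<^esup> \<subseteq> F"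
  shows "permitted_copy W (\<lambda>e. {\<chi> e}) V g"
proof -
  obtain f where f: "f \<in> W \<rightarrow> V" "inj_on f W"
    and same_label: "\<And>e. e \<in> [W]\<^bsup>2\<^esup> \<Longrightarrow> l (g (f ` e)) = l (\<chi> e)"
    using assms(1) unfolding permitted_copy_def by blast
  have "g (f ` e) = \<chi> e" if e: "e \<in> [W]\<^bsup>2\<^esup>" for e
  proof (rule inj_onD[OF l same_label[OF e]])
    show "g (f ` e) \<in> F" using funcset_mem[OF nsets_image_funcset[OF f] e] g by blast
    show "\<chi> e \<in> F" using \<chi> e by blast
  qed
  then show ?thesis using f by (auto simp: permitted_copy_def)
qed

lemma permitted_copy_or_fewer_colours:
  fixes V :: "'a set" and g :: "'a set \<Rightarrow> 'b"
  assumes D: "\<And>\<chi>. edge_colouring p m \<chi> \<Longrightarrow> erdos_hajnal_exponent p m \<chi> D"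
    and "finite V" and m: "card (g ` [V]\<^bsup>2\<^esup>) = m" and k: "1 \<le> k" "k ^ D \<le> card V"
    and \<chi>: "\<chi> ` [{1..p}]\<^bsup>2\<^esup> \<subseteq> g ` [V]\<^bsup>2\<^esup>"
  shows "permitted_copy {1..p} (\<lambda>e. {\<chi> e}) V g \<or> (\<exists>S\<subseteq>V. k \<le> card S \<and> card (g ` [S]\<^bsup>2\<^esup>) < m)"
proof -
  obtain h where h: "bij_betw h {1..card V} V"
    using ex_bij_betw_nat_finite_1[OF \<open>finite V\<close>] by blast
  have "finite (g ` [V]\<^bsup>2\<^esup>)" using \<open>finite V\<close> by (simp add: finite_imp_finite_nsets)
  then obtain l where l: "bij_betw l (g ` [V]\<^bsup>2\<^esup>) {1..m}"
    using m by (metis card_atLeastAtMost diff_Suc_1 finite_atLeastAtMost finite_same_card_bij)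
  define c where "c = (\<lambda>e. l (g (h ` e)))"
  have "(\<lambda>e. g (h ` e)) ` [{1..card V}]\<^bsup>2\<^esup> = g ` [V]\<^bsup>2\<^esup>"
    using h by (subst image_nsets_reindex) (auto simp: bij_betw_def)
  then have c: "edge_colouring (card V) m c"
    unfolding edge_colouring_def c_def using bij_betwE[OF l] by blast
  have "edge_colouring p m (\<lambda>e. l (\<chi> e))"
    unfolding edge_colouring_def using \<chi> bij_betwE[OF l] by blast
  then have "erdos_hajnal_exponent p m (\<lambda>e. l (\<chi> e)) D" by (rule D)
  with c k consider (copy) "contains_colour_copy (card V) c p (\<lambda>e. l (\<chi> e))"
    | (fewer) S where "S \<subseteq> {1..card V}" "k \<le> card S" "card (c ` [S]\<^bsup>2\<^esup>) < m"
    unfolding erdos_hajnal_exponent_def by blast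
  then show ?thesis
  proof cases
    case copy
    then have "permitted_copy {1..p} (\<lambda>e. {l (\<chi> e)}) {1..card V} (\<lambda>e. l (g (h ` e)))"
      by (simp only: contains_colour_copy_eq_permitted_copy c_def)
    then have "permitted_copy {1..p} (\<lambda>e. {l (\<chi> e)}) V (\<lambda>e. l (g e))"
      using h by (rule permitted_copy_reindex)
    then show ?thesis using permitted_copy_relabel bij_betw_imp_inj_on[OF l] \<chi> by blast
  next
    case (fewer S)
    have inj: "inj_on h S" using fewer(1) h by (auto simp: bij_betw_def intro: inj_on_subset)
    have hS: "h ` S \<subseteq> V" using fewer(1) h by (auto simp: bij_betw_def)
    have "card (g ` [h ` S]\<^bsup>2\<^esup>) < m"
      using card_image_nsets_relabel[OF inj bij_betw_imp_inj_on[OF l] image_mono[OF nsets_mono[OF hS]]]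
        fewer(3) by (simp add: c_def)
    moreover have "k \<le> card (h ` S)" using fewer(2) inj by (simp add: card_image)
    ultimately show ?thesis using hS by blast
  qed
qed

lemma avoids_permitted_or_permitted_choice:
  assumes "k \<le> card V"
  obtains (avoids) "avoids_permitted k W L V g"
    | (choice) \<chi> where "\<chi> ` [W]\<^bsup>2\<^esup> \<subseteq> g ` [V]\<^bsup>2\<^esup>" "\<And>e. e \<in> [W]\<^bsup>2\<^esup> \<Longrightarrow> \<chi> e \<in> L e"
proof (cases "\<exists>e\<in>[W]\<^bsup>2\<^esup>. g ` [V]\<^bsup>2\<^esup> \<inter> L e = {}")
  case True
  then show thesis using avoids assms unfolding avoids_permitted_def by blast
next
  case False
  then have "\<forall>e\<in>[W]\<^bsup>2\<^esup>. \<exists>b. b \<in> g ` [V]\<^bsup>2\<^esup> \<and> b \<in> L e" by blast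
  then obtain \<chi> where "\<And>e. e \<in> [W]\<^bsup>2\<^esup> \<Longrightarrow> \<chi> e \<in> g ` [V]\<^bsup>2\<^esup> \<and> \<chi> e \<in> L e" by metis
  then show thesis by (intro choice) auto
qed

lemma permitted_copy_or_avoids_permitted_if_one_colour:
  assumes "finite V" and one_colour: "card (g ` [V]\<^bsup>2\<^esup>) \<le> 1"
    and "finite W" and "card W \<le> card V" and "k \<le> card V"
  shows "permitted_copy W L V g \<or> avoids_permitted k W L V g"
  using \<open>k \<le> card V\<close>
proof (cases rule: avoids_permitted_or_permitted_choice[where W = W and L = L and g = g])
  case (choice \<chi>)
  obtain f where "f ` W \<subseteq> V" and inj: "inj_on f W"
    using card_le_inj[OF \<open>finite W\<close> \<open>finite V\<close> \<open>card W \<le> card V\<close>] by blast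
  then have f: "f \<in> W \<rightarrow> V" by blast
  have "finite (g ` [V]\<^bsup>2\<^esup>)" using \<open>finite V\<close> by (simp add: finite_imp_finite_nsets)
  then have same_colour: "b = b'" if "b \<in> g ` [V]\<^bsup>2\<^esup>" "b' \<in> g ` [V]\<^bsup>2\<^esup>" for b b'
    using one_colour that by (metis One_nat_def card_le_Suc0_iff_eq)
  have "g (f ` e) = \<chi> e" if e: "e \<in> [W]\<^bsup>2\<^esup>" for e
    using funcset_mem[OF nsets_image_funcset[OF f inj] e] choice(1) e by (intro same_colour) auto
  then have "permitted_copy W L V g" using f inj choice(2) unfolding permitted_copy_def by metis
  then show ?thesis ..
qed blast

lemma permitted_copy_or_avoids_permitted_or_fewer_colours:
  assumes D: "\<And>\<chi>. edge_colouring p m \<chi> \<Longrightarrow> erdos_hajnal_exponent p m \<chi> D"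
    and "finite V" and m: "card (g ` [V]\<^bsup>2\<^esup>) = m"
    and k: "1 \<le> k" "k ^ D \<le> card V" and "k \<le> card V"
  shows "permitted_copy {1..p} L V g \<or> avoids_permitted k {1..p} L V g \<or>
    (\<exists>S\<subseteq>V. k \<le> card S \<and> card (g ` [S]\<^bsup>2\<^esup>) < m)"
  using \<open>k \<le> card V\<close>
proof (cases rule: avoids_permitted_or_permitted_choice[where W = "{1..p}" and L = L and g = g])
  case (choice \<chi>)
  from permitted_copy_or_fewer_colours[OF D \<open>finite V\<close> m k choice(1)] show ?thesis
    using permitted_copy_mono[of "{1..p}" "\<lambda>e. {\<chi> e}" V g V L] choice(2) by auto
qed blast

lemma permitted_copy_or_avoids_permitted_Suc_colours:
  assumes D': "\<And>\<chi>. edge_colouring p (Suc m) \<chi> \<Longrightarrow> erdos_hajnal_exponent p (Suc m) \<chi> D'"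
    and fewer_colours: "\<And>S. S \<subseteq> V \<Longrightarrow> card (g ` [S]\<^bsup>2\<^esup>) \<le> m \<Longrightarrow> k ^ D \<le> card S \<Longrightarrow>
      permitted_copy {1..p} L S g \<or> avoids_permitted k {1..p} L S g"
    and "finite V" and colours: "card (g ` [V]\<^bsup>2\<^esup>) \<le> Suc m"
    and k: "2 \<le> k" "k ^ (Suc D * Suc D') \<le> card V"
  shows "permitted_copy {1..p} L V g \<or> avoids_permitted k {1..p} L V g"
proof -
  \<comment> \<open>Erdos-Hajnal is applied with \<open>k ^ Suc D\<close> for \<open>k\<close>, leaving enough vertices for \<open>fewer_colours\<close>.\<close>
  have V_large: "k ^ j \<le> card V" if "j \<le> Suc D * Suc D'" for j
    using power_increasing[OF that, of k] k by linarith
  show ?thesis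
  proof (cases "card (g ` [V]\<^bsup>2\<^esup>) \<le> m")
    case True
    then show ?thesis using fewer_colours[of V] V_large[of D] by simp
  next
    case False
    then have "card (g ` [V]\<^bsup>2\<^esup>) = Suc m" using colours by simp
    moreover have "(k ^ Suc D) ^ D' \<le> card V" "k ^ Suc D \<le> card V"
      by (auto simp only: power_mult[symmetric] intro!: V_large) simp_all
    ultimately consider (copy) "permitted_copy {1..p} L V g"
      | (avoids) "avoids_permitted (k ^ Suc D) {1..p} L V g"
      | (fewer) S where "S \<subseteq> V" "k ^ Suc D \<le> card S" "card (g ` [S]\<^bsup>2\<^esup>) \<le> m"
      using permitted_copy_or_avoids_permitted_or_fewer_colours[OF D' \<open>finite V\<close>, of g "k ^ Suc D" L] k
      by (auto simp: less_Suc_eq_le)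
    then show ?thesis
    proof cases
      case avoids
      moreover have "k \<le> k ^ Suc D" using k by (intro self_le_power) auto
      ultimately show ?thesis using avoids_permitted_mono by blast
    next
      case (fewer S)
      have "k ^ D \<le> k ^ Suc D" using k by (intro power_increasing) auto
      also note \<open>k ^ Suc D \<le> card S\<close>
      finally have "permitted_copy {1..p} L S g \<or> avoids_permitted k {1..p} L S g"
        using fewer by (intro fewer_colours)
      then show ?thesis using permitted_copy_mono avoids_permitted_mono \<open>S \<subseteq> V\<close> by blast
    qed blast
  qed
qed

lemma ex_exponent_permitted_copy_or_avoids_permitted:
  fixes p m :: nat and L :: "nat set \<Rightarrow> 'b set"
  assumes EH: "multicolour_erdos_hajnal" and "1 \<le> m"
  shows "\<exists>D. \<forall>(V :: 'a set) (g :: 'a set \<Rightarrow> 'b) k.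
    finite V \<longrightarrow> card (g ` [V]\<^bsup>2\<^esup>) \<le> m \<longrightarrow> 2 \<le> k \<longrightarrow> k ^ D \<le> card V \<longrightarrow>
      permitted_copy {1..p} L V g \<or> avoids_permitted k {1..p} L V g"
    (is "\<exists>D. ?exponent m D")
  using \<open>1 \<le> m\<close>
proof (induction m rule: nat_induct_at_least)
  case base
  have "?exponent 1 (Suc p)"
  proof (intro allI impI)
    fix V :: "'a set" and g :: "'a set \<Rightarrow> 'b" and k :: nat
    assume V: "finite V" "card (g ` [V]\<^bsup>2\<^esup>) \<le> 1" and k: "2 \<le> k" "k ^ Suc p \<le> card V"
    have "p < k ^ p" using k by (intro power_gt_expt) simp
    moreover have "k ^ p \<le> k ^ Suc p" "k \<le> k ^ Suc p"
      using k by (intro power_increasing self_le_power; simp)+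
    ultimately have "p \<le> card V" "k \<le> card V" using k(2) by linarith+
    then show "permitted_copy {1..p} L V g \<or> avoids_permitted k {1..p} L V g"
      using V by (intro permitted_copy_or_avoids_permitted_if_one_colour) auto
  qed
  then show ?case ..
next
  case (Suc m)
  then obtain D where D: "?exponent m D" by blast
  obtain D' where D': "\<And>\<chi>. edge_colouring p (Suc m) \<chi> \<Longrightarrow> erdos_hajnal_exponent p (Suc m) \<chi> D'"
    using ex_uniform_erdos_hajnal_exponent[OF EH, of "Suc m" p] \<open>1 \<le> m\<close> by auto
  have "?exponent (Suc m) (Suc D * Suc D')"
  proof (intro allI impI)
    fix V :: "'a set" and g :: "'a set \<Rightarrow> 'b" and k :: nat
    assume V: "finite V" "card (g ` [V]\<^bsup>2\<^esup>) \<le> Suc m" and k: "2 \<le> k" "k ^ (Suc D * Suc D') \<le> card V"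
    have "permitted_copy {1..p} L S g \<or> avoids_permitted k {1..p} L S g"
      if "S \<subseteq> V" "card (g ` [S]\<^bsup>2\<^esup>) \<le> m" "k ^ D \<le> card S" for S
      using D that k \<open>finite V\<close> by (meson finite_subset)
    from permitted_copy_or_avoids_permitted_Suc_colours[OF D' this V k]
    show "permitted_copy {1..p} L V g \<or> avoids_permitted k {1..p} L V g" .
  qed
  then show ?case ..
qed

section \<open>Grids\<close>

definition column_graph :: "grid_graph \<Rightarrow> nat \<Rightarrow> nat set set" where
  "column_graph G x = {e. Pair x ` e \<in> edges G}"

definition row_graph :: "grid_graph \<Rightarrow> nat \<Rightarrow> nat set set" where
  "row_graph G y = {e. (\<lambda>x. (x, y)) ` e \<in> edges G}"

definition joining_rows :: "grid_graph \<Rightarrow> nat set \<Rightarrow> nat set" where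
  "joining_rows G e = {y. e \<in> row_graph G y}"

definition row_set_colouring :: "grid_graph \<Rightarrow> (nat \<Rightarrow> nat) \<Rightarrow> nat \<Rightarrow> nat set \<Rightarrow> nat set" where
  "row_set_colouring G h R e = h -` joining_rows G e \<inter> {1..R}"

definition permitted_row_sets :: "grid_graph \<Rightarrow> nat set \<Rightarrow> nat set set" where
  "permitted_row_sets H e = {B. joining_rows H e \<subseteq> B}"

lemma card_row_set_colouring: "card (row_set_colouring G h R ` A) \<le> 2 ^ R"
proof -
  have "card (row_set_colouring G h R ` A) \<le> card (Pow {1..R})"
    by (intro card_mono) (auto simp: row_set_colouring_def)
  then show ?thesis by (simp add: card_Pow)
qed

lemma indep_column_imp_grid_coclique:
  assumes "Pair x ` S \<subseteq> verts G" and "finite S" and "indep S (column_graph G x)"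
  shows "grid_coclique G (card S) (Pair x ` S)"
  using assms
  by (auto simp: grid_coclique_def indep_def column_graph_def card_image inj_on_def pairwise_def)

lemma indep_row_imp_grid_coclique:
  assumes "(\<lambda>x. (x, y)) ` S \<subseteq> verts G" and "finite S" and "indep S (row_graph G y)"
  shows "grid_coclique G (card S) ((\<lambda>x. (x, y)) ` S)"
  using assms
  by (auto simp: grid_coclique_def indep_def row_graph_def card_image inj_on_def pairwise_def)

lemma verts_spanning_grid_subgraph:
  "spanning_grid_subgraph N G \<Longrightarrow> verts G = {1..cols G} \<times> {1..rows G}"
  by (auto simp: spanning_grid_subgraph_def complete_grid_def)

lemma columns_with_common_clique:
  assumes G: "spanning_grid_subgraph (k ^ (2 * R * R + D)) G" and "2 \<le> k"
    and no_coclique: "\<nexists>S. grid_coclique G k S"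
  obtains h V where "h \<in> {1..R} \<rightarrow> {1..rows G}" "inj_on h {1..R}"
    "V \<subseteq> {1..cols G}" "k ^ D \<le> card V" "\<And>x. x \<in> V \<Longrightarrow> clique (h ` {1..R}) (column_graph G x)"
proof -
  have size: "cols G = k ^ (2 * R * R + D)" "rows G = k ^ (2 * R * R + D)"
    using G by (auto simp: spanning_grid_subgraph_def)
  have "2 * R \<le> 2 * R * R + D" by (cases R) auto
  then have "k ^ (2 * R) \<le> rows G" using size \<open>2 \<le> k\<close> by (auto intro: power_increasing)
  moreover have "\<not> indep S (column_graph G x)"
    if "x \<in> {1..cols G}" "S \<subseteq> {1..rows G}" "card S = k" for x S
  proof -
    have "Pair x ` S \<subseteq> verts G" "finite S"
      using that verts_spanning_grid_subgraph[OF G] by (auto intro: finite_subset)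
    then show ?thesis using indep_column_imp_grid_coclique no_coclique \<open>card S = k\<close> by blast
  qed
  ultimately obtain K V where K: "K \<in> [{1..rows G}]\<^bsup>R\<^esup>" and V: "V \<subseteq> {1..cols G}" "k ^ D \<le> card V"
    and clique: "\<And>x. x \<in> V \<Longrightarrow> clique K (column_graph G x)"
    using common_clique_of_many_graphs[of "{1..cols G}" k R D "{1..rows G}" "column_graph G"]
      size \<open>2 \<le> k\<close> by (metis card_atLeastAtMost diff_Suc_1 finite_atLeastAtMost order_refl)
  obtain h where "bij_betw h {1..R} K"
    using K ex_bij_betw_nat_finite_1[of K] by (auto simp: nsets_def)
  then show thesis
    using K V clique by (intro that[of h V]) (auto simp: bij_betw_def nsets_def)
qed

lemma grid_subgraph_edge:
  assumes "grid_subgraph H" and "{(x, y), (x', y')} \<in> edges H"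
  shows "(x, y) \<in> verts H \<and> (x', y') \<in> verts H \<and> (x = x' \<and> y \<noteq> y' \<or> x \<noteq> x' \<and> y = y')"
proof -
  obtain a b a' b' where ab: "{(x, y), (x', y')} = {(a, b), (a', b')}"
    "(a, b) \<in> verts H" "(a', b') \<in> verts H" "(a, b) \<noteq> (a', b')" "a = a' \<or> b = b'"
    using assms unfolding grid_subgraph_def by meson
  from ab(1) have "(x, y) = (a, b) \<and> (x', y') = (a', b') \<or> (x, y) = (a', b') \<and> (x', y') = (a, b)"
    by (simp only: doubleton_eq_iff)
  then show ?thesis using ab(2-) by auto
qed

lemma joining_rows_subset:
  assumes "grid_subgraph H" and "e \<in> [W]\<^bsup>2\<^esup>"
  shows "joining_rows H e \<subseteq> {1..rows H}"
proof
  fix y assume y: "y \<in> joining_rows H e"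
  obtain x x' where "e = {x, x'}" using \<open>e \<in> [W]\<^bsup>2\<^esup>\<close> by (rule nsets2_E)
  with y have "{(x, y), (x', y)} \<in> edges H" by (simp add: joining_rows_def row_graph_def)
  then have "(x, y) \<in> verts H" using grid_subgraph_edge[OF \<open>grid_subgraph H\<close>] by blast
  then show "y \<in> {1..rows H}" using \<open>grid_subgraph H\<close> by (auto simp: grid_subgraph_def)
qed

lemma grid_embeddingI:
  assumes H: "grid_subgraph H"
    and f: "f \<in> {1..cols H} \<rightarrow> {1..cols G}" "inj_on f {1..cols H}"
    and h: "h \<in> {1..rows H} \<rightarrow> {1..rows G}" "inj_on h {1..rows H}"
    and column_cliques: "\<And>x. x \<in> {1..cols H} \<Longrightarrow> clique (h ` {1..rows H}) (column_graph G (f x))"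
    and rows_joined: "\<And>e y. e \<in> [{1..cols H}]\<^bsup>2\<^esup> \<Longrightarrow> y \<in> joining_rows H e \<Longrightarrow>
      h y \<in> joining_rows G (f ` e)"
  shows "grid_embedding H G f h"
  unfolding grid_embedding_def
proof (intro conjI allI impI)
  fix x y x' y' assume e: "{(x, y), (x', y')} \<in> edges H"
  note edge = grid_subgraph_edge[OF H e]
  then have range: "x \<in> {1..cols H}" "x' \<in> {1..cols H}" "y \<in> {1..rows H}" "y' \<in> {1..rows H}"
    using H by (auto simp: grid_subgraph_def)
  from edge consider (vertical) "x = x'" "y \<noteq> y'" | (horizontal) "x \<noteq> x'" "y = y'" by blast
  then show "{(f x, h y), (f x', h y')} \<in> edges G"
  proof cases
    case vertical
    then have "h y \<noteq> h y'" using h(2) range by (auto dest: inj_onD)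
    then show ?thesis using vertical column_cliques[OF range(1)] range
      by (simp add: clique_def column_graph_def)
  next
    case horizontal
    then have "h y \<in> joining_rows G (f ` {x, x'})"
      using e range by (intro rows_joined) (auto simp: joining_rows_def row_graph_def)
    then show ?thesis using horizontal by (simp add: joining_rows_def row_graph_def)
  qed
qed (use f h in auto)

lemma grid_contains_if_permitted_copy:
  assumes "grid_subgraph H"
    and h: "h \<in> {1..rows H} \<rightarrow> {1..rows G}" "inj_on h {1..rows H}"
    and V: "V \<subseteq> {1..cols G}" "\<And>x. x \<in> V \<Longrightarrow> clique (h ` {1..rows H}) (column_graph G x)"
    and copy: "permitted_copy {1..cols H} (permitted_row_sets H) V (row_set_colouring G h (rows H))"
  shows "grid_contains G H"
proof -
  obtain f where f: "f \<in> {1..cols H} \<rightarrow> V" "inj_on f {1..cols H}"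
    "\<And>e. e \<in> [{1..cols H}]\<^bsup>2\<^esup> \<Longrightarrow> joining_rows H e \<subseteq> h -` joining_rows G (f ` e) \<inter> {1..rows H}"
    using copy unfolding permitted_copy_def row_set_colouring_def permitted_row_sets_def by blast
  have "grid_embedding H G f h"
    using f h V by (intro grid_embeddingI \<open>grid_subgraph H\<close>) blast+
  then show ?thesis unfolding grid_contains_def by blast
qed

lemma joining_rows_subset_singleton:
  assumes "\<And>e e' x x'. horizontal_edge_between H e x x' \<Longrightarrow> horizontal_edge_between H e' x x' \<Longrightarrow> e = e'"
    and "e \<in> [W]\<^bsup>2\<^esup>"
  shows "\<exists>y. joining_rows H e \<subseteq> {y}"
proof -
  obtain x x' where e: "e = {x, x'}" "x \<noteq> x'" using \<open>e \<in> [W]\<^bsup>2\<^esup>\<close> by (rule nsets2_E)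
  have "horizontal_edge_between H {(x, z), (x', z)} x x'" if "z \<in> joining_rows H e" for z
    using that e by (auto simp: horizontal_edge_between_def joining_rows_def row_graph_def)
  then have "{(x, y), (x', y)} = {(x, y'), (x', y')}"
    if "y \<in> joining_rows H e" "y' \<in> joining_rows H e" for y y'
    using that assms(1) by blast
  then have "y = y'" if "y \<in> joining_rows H e" "y' \<in> joining_rows H e" for y y'
    using that e by (fastforce simp: doubleton_eq_iff)
  then show ?thesis by blast
qed

lemma grid_coclique_if_avoids_permitted:
  assumes H: "grid_subgraph H" and single: "\<forall>e\<in>[{1..cols H}]\<^bsup>2\<^esup>. \<exists>y. joining_rows H e \<subseteq> {y}"
    and h: "h \<in> {1..rows H} \<rightarrow> {1..rows G}" and G: "verts G = {1..cols G} \<times> {1..rows G}"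
    and V: "V \<subseteq> {1..cols G}" and "2 \<le> k"
    and avoids: "avoids_permitted k {1..cols H} (permitted_row_sets H) V
      (row_set_colouring G h (rows H))"
  shows "\<exists>S. grid_coclique G k S"
proof -
  obtain e S where e: "e \<in> [{1..cols H}]\<^bsup>2\<^esup>" and "S \<subseteq> V" "k \<le> card S"
    and no_permitted: "row_set_colouring G h (rows H) ` [S]\<^bsup>2\<^esup> \<inter> permitted_row_sets H e = {}"
    using avoids unfolding avoids_permitted_def by blast
  have S: "\<not> joining_rows H e \<subseteq> h -` joining_rows G e' \<inter> {1..rows H}" if "e' \<in> [S]\<^bsup>2\<^esup>" for e'
    using no_permitted that by (auto simp: row_set_colouring_def permitted_row_sets_def)
  obtain T where T: "T \<subseteq> S" "card T = k" "finite T"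
    using obtain_subset_with_card_n[OF \<open>k \<le> card S\<close>] by blast
  have "[T]\<^bsup>2\<^esup> \<noteq> {}" using T \<open>2 \<le> k\<close> by (simp add: nsets_eq_empty_iff)
  then obtain y where y: "y \<in> joining_rows H e" using S nsets_mono[OF \<open>T \<subseteq> S\<close>] by blast
  then have joining: "joining_rows H e = {y}" using single e by blast
  have y_row: "y \<in> {1..rows H}" using joining_rows_subset[OF H e] y by blast
  have "e' \<notin> row_graph G (h y)" if "e' \<in> [T]\<^bsup>2\<^esup>" for e'
    using S[of e'] nsets_mono[OF \<open>T \<subseteq> S\<close>] that joining y_row by (auto simp: joining_rows_def)
  then have "indep T (row_graph G (h y))" by (simp add: indep_def)
  moreover have "(\<lambda>x. (x, h y)) ` T \<subseteq> verts G"
    using \<open>T \<subseteq> S\<close> \<open>S \<subseteq> V\<close> V G h y_row by auto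
  ultimately show ?thesis using indep_row_imp_grid_coclique T by blast
qed

lemma grid_contains_or_grid_coclique:
  assumes H: "grid_subgraph H"
    and single: "\<forall>e\<in>[{1..cols H}]\<^bsup>2\<^esup>. \<exists>y. joining_rows H e \<subseteq> {y}"
    and "2 \<le> k" and G: "spanning_grid_subgraph (k ^ (2 * rows H * rows H + D)) G"
    and dichotomy: "\<And>(V :: nat set) g.
      finite V \<Longrightarrow> card (g ` [V]\<^bsup>2\<^esup>) \<le> 2 ^ rows H \<Longrightarrow> k ^ D \<le> card V \<Longrightarrow>
      permitted_copy {1..cols H} (permitted_row_sets H) V g \<or>
      avoids_permitted k {1..cols H} (permitted_row_sets H) V g"
  shows "grid_contains G H \<or> (\<exists>S. grid_coclique G k S)"
proof (rule disjCI)
  assume no_coclique: "\<nexists>S. grid_coclique G k S"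
  obtain h V where h: "h \<in> {1..rows H} \<rightarrow> {1..rows G}" "inj_on h {1..rows H}"
    and V: "V \<subseteq> {1..cols G}" and large: "k ^ D \<le> card V"
    and clique: "\<And>x. x \<in> V \<Longrightarrow> clique (h ` {1..rows H}) (column_graph G x)"
    using columns_with_common_clique[OF G \<open>2 \<le> k\<close> no_coclique] by blast
  have "finite V" using V by (rule finite_subset) simp
  then have "permitted_copy {1..cols H} (permitted_row_sets H) V (row_set_colouring G h (rows H)) \<or>
      avoids_permitted k {1..cols H} (permitted_row_sets H) V (row_set_colouring G h (rows H))"
    using card_row_set_colouring large by (rule dichotomy)
  moreover have "\<not> avoids_permitted k {1..cols H} (permitted_row_sets H) V
      (row_set_colouring G h (rows H))"
    using grid_coclique_if_avoids_permitted[OF H single h(1) verts_spanning_grid_subgraph[OF G] V]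
      \<open>2 \<le> k\<close> no_coclique by blast
  ultimately show "grid_contains G H"
    using grid_contains_if_permitted_copy[OF H h V clique] by blast
qed

lemma gr_leI:
  assumes "\<And>G. spanning_grid_subgraph N G \<Longrightarrow> grid_contains G H \<or> (\<exists>S. grid_coclique G k S)"
  shows "gr H k \<le> enat N"
  unfolding gr_def using assms by (intro Inf_lower) auto

theorem theorem1p5:
  fixes H :: grid_graph
  assumes "multicolour_erdos_hajnal"
    and "grid_subgraph H"
    and "\<And>e e' x x'. horizontal_edge_between H e x x' \<Longrightarrow> horizontal_edge_between H e' x x' \<Longrightarrow> e = e'"
  shows "H \<in> PGR"
proof -
  obtain D where dichotomy: "\<And>(V :: nat set) g k.
      finite V \<Longrightarrow> card (g ` [V]\<^bsup>2\<^esup>) \<le> 2 ^ rows H \<Longrightarrow> 2 \<le> k \<Longrightarrow> k ^ D \<le> card V \<Longrightarrow>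
      permitted_copy {1..cols H} (permitted_row_sets H) V g \<or>
      avoids_permitted k {1..cols H} (permitted_row_sets H) V g"
    using ex_exponent_permitted_copy_or_avoids_permitted[OF assms(1), of "2 ^ rows H"]
    by (metis one_le_numeral one_le_power)
  have single: "\<forall>e\<in>[{1..cols H}]\<^bsup>2\<^esup>. \<exists>y. joining_rows H e \<subseteq> {y}"
    using joining_rows_subset_singleton assms(3) by blast
  have "gr H k \<le> enat (k ^ (2 * rows H * rows H + D))" if "2 \<le> k" for k
  proof (rule gr_leI)
    fix G assume "spanning_grid_subgraph (k ^ (2 * rows H * rows H + D)) G"
    with assms(2) single \<open>2 \<le> k\<close>
    show "grid_contains G H \<or> (\<exists>S. grid_coclique G k S)"
      by (rule grid_contains_or_grid_coclique) (rule dichotomy[OF _ _ \<open>2 \<le> k\<close>])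
  qed
  then show ?thesis using assms(2) by (auto simp: PGR_def)
qed

end
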